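(* Let $(A,+,\cdot)$ be a left brace, let $p$ and $q$ be distinct prime numbers, and let $A_p$, $A_q$ be the Sylow $p$-subgroup and the Sylow $q$-subgroup of the additive group $(A,+)$, of cardinalities $p^n$ and $q^m$ respectively, for some natural numbers $m,n\ge 1$. Then the following hold. 1. If $p$ does not divide $q^t-1$ for any $1\le t\le m$, then $A_p\cdot A_q=0$, i.e. $a\cdot b=0$ for all $a\in A_p$, $b\in A_q$. 2. Let $a\in A_p$, $b\in A_q$, and let $k$ be the maximal nonnegative integer such that $p^k$ divides $q^t-1$ for some $1\le t\le m$. Then $a^{\circ(p^k)}\cdot b=0$.
   Context: A left brace is an abelian group $(A,+)$ with a multiplication $\cdot$ such that $a\cdot(b+c)=a\cdot b+a\cdot c$ for all $a,b,c\in A$ and such that the circle operation $a\circ b=a\cdot b+a+b$ makes $A$ into a group, called the adjoint group $A^\circ$ (its identity is $0$). For $a\in A$ and $n\ge 1$, $a^{\circ(n)}=a\circ a\circ\cdots\circ a$ ($n$ factors) is the $n$-th power of $a$ in $A^\circ$. The Sylow $p$-subgroup of the abelian group $(A,+)$ is the subgroup of all elements whose additive order is a power of $p$. *)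

theory Defs
  imports "HOL-Algebra.Multiplicative_Group" "HOL-Computational_Algebra.Primes"
begin

(* A brace is carried by the record type of rings, whose signature supplies the
   addition and the multiplication.  The field "one" of the record plays no role:
   nothing is assumed about it. *)

definition adjoint_group :: "('a, 'm) ring_scheme \<Rightarrow> 'a monoid" where
  "adjoint_group A =
     \<lparr>carrier = carrier A, monoid.mult = (\<lambda>a b. a \<otimes>\<^bsub>A\<^esub> b \<oplus>\<^bsub>A\<^esub> a \<oplus>\<^bsub>A\<^esub> b), one = \<zero>\<^bsub>A\<^esub>\<rparr>"

locale left_brace = abelian_group A for A (structure) +
  assumes m_closed: "\<lbrakk>a \<in> carrier A; b \<in> carrier A\<rbrakk> \<Longrightarrow> a \<otimes> b \<in> carrier A"
    and r_distr: "\<lbrakk>a \<in> carrier A; b \<in> carrier A; c \<in> carrier A\<rbrakk>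
      \<Longrightarrow> a \<otimes> (b \<oplus> c) = a \<otimes> b \<oplus> a \<otimes> c"
    and group_adjoint_group: "group (adjoint_group A)"

(* group.ord is 0 on elements of infinite order, so these are excluded for p > 0. *)

definition add_sylow :: "('a, 'm) ring_scheme \<Rightarrow> nat \<Rightarrow> 'a set" where
  "add_sylow A p = {a \<in> carrier A. \<exists>i. group.ord (add_monoid A) a = p ^ i}"

end

theory Submission
  imports Defs
begin

text \<open>
  In a left brace the maps \<open>\<lambda>\<^sub>a(b) = a \<cdot> b + b\<close> are additive and \<open>\<lambda>\<close> is an action of the adjoint
  group; hence \<open>A\<^sub>p\<close> is a subgroup of the adjoint group, and the restriction \<open>f\<close> of \<open>\<lambda>\<^sub>a\<close> to
  \<open>A\<^sub>q\<close>, for \<open>a \<in> A\<^sub>p\<close>, has order \<open>p\<^sup>l\<close> for some \<open>l\<close>.  If \<open>l \<ge> 1\<close>, put \<open>h = f\<^bsup>p^(l-1)\<^esup> \<noteq> 1\<close>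
  and \<open>V = (h - 1) A\<^sub>q \<noteq> 0\<close>.  As \<open>h\<^sup>p = 1\<close> and \<open>p\<close> is invertible on \<open>A\<^sub>q\<close>, the map \<open>h\<close> fixes no
  nonzero element of \<open>V\<close>, so all orbits of \<open>f\<close> on \<open>V - {0}\<close> have exactly \<open>p\<^sup>l\<close> elements, and
  \<open>p\<^sup>l\<close> divides \<open>card V - 1 = q\<^sup>t - 1\<close>.
\<close>

section \<open>Periods of iterates and cycles of prime power length\<close>

lemma funpow_mult_fixed:
  assumes "(f ^^ a) v = v"
  shows "(f ^^ (a * x)) v = v"
  using assms by (induction x) (simp_all add: funpow_add)

text \<open>Bezout enters in the subtraction-free form \<open>a * x = b * y + gcd a b\<close>, since
  \<open>f\<close> need not be invertible.\<close>

lemma funpow_gcd_fixed: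
  assumes a: "(f ^^ a) v = v" and b: "(f ^^ b) v = v"
  shows "(f ^^ gcd a b) v = v"
proof (cases "a = 0")
  case True
  then show ?thesis using b by simp
next
  case False
  then obtain x y where "a * x = b * y + gcd a b"
    using bezout_nat by blast
  then have "(f ^^ (gcd a b + b * y)) v = v"
    using funpow_mult_fixed[OF a, of x] by (simp add: add.commute)
  then show ?thesis
    using funpow_mult_fixed[OF b, of y] by (simp add: funpow_add)
qed

text \<open>The least period of \<open>v\<close> divides \<open>p ^ Suc l\<close> but not
  \<open>p ^ l\<close>, so it is \<open>p ^ Suc l\<close>.\<close>

lemma inj_on_funpow_prime_power:
  fixes p :: nat
  assumes p: "Factorial_Ring.prime p"
    and per: "(f ^^ (p ^ Suc l)) v = v"
    and nonfix: "(f ^^ (p ^ l)) v \<noteq> v"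
  shows "inj_on (\<lambda>i. (f ^^ i) v) {..<p ^ Suc l}"
proof (rule linorder_inj_onI')
  fix i j assume ij: "i \<in> {..<p ^ Suc l}" "j \<in> {..<p ^ Suc l}" "i < j"
  show "(f ^^ i) v \<noteq> (f ^^ j) v"
  proof
    assume eq: "(f ^^ i) v = (f ^^ j) v"
    \<comment> \<open>Another \<open>r\<close> applications of \<open>f\<close> take
      \<open>(f ^^ j) v\<close> to \<open>v\<close>, so \<open>r + i\<close> is a period too;
      \<open>i < j\<close> puts it strictly between \<open>0\<close> and
      \<open>p ^ Suc l\<close>.\<close>
    define r where "r = p ^ Suc l - j"
    have "(f ^^ (r + i)) v = (f ^^ (r + j)) v"
      using eq by (simp add: funpow_add)
    also have "\<dots> = v"
      using ij per by (simp add: r_def)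
    finally have "(f ^^ gcd (r + i) (p ^ Suc l)) v = v"
      using per by (rule funpow_gcd_fixed)
    moreover obtain s where s: "s \<le> Suc l" "gcd (r + i) (p ^ Suc l) = p ^ s"
      using p by (metis divides_primepow_nat gcd_dvd2)
    moreover have "s \<noteq> Suc l"
    proof
      assume "s = Suc l"
      then have "p ^ Suc l dvd r + i" using s by (metis gcd_dvd1)
      moreover have "0 < r + i" "r + i < p ^ Suc l" using ij by (auto simp: r_def)
      ultimately show False using nat_dvd_not_less[of "r + i" "p ^ Suc l"] by metis
    qed
    ultimately have "(f ^^ (p ^ s)) v = v" "s \<le> l" by auto
    then have "(f ^^ (p ^ s * p ^ (l - s))) v = v"
      by (intro funpow_mult_fixed)
    then show False
      using nonfix \<open>s \<le> l\<close> by (simp flip: power_add)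
  qed
qed

text \<open>Under \<open>f\<close> the set splits into cycles of exactly \<open>p ^ Suc l\<close>
  elements; the induction removes one cycle \<open>?O\<close> at a time.\<close>

lemma prime_power_dvd_card:
  fixes p :: nat
  assumes p: "Factorial_Ring.prime p" and "finite X" and "f ` X \<subseteq> X"
    and "\<And>v. v \<in> X \<Longrightarrow> (f ^^ (p ^ Suc l)) v = v"
    and "\<And>v. v \<in> X \<Longrightarrow> (f ^^ (p ^ l)) v \<noteq> v"
  shows "p ^ Suc l dvd card X"
  using assms(2-)
proof (induction X rule: finite_psubset_induct)
  case (psubset X)
  let ?N = "p ^ Suc l"
  have N: "?N > 0" using p prime_gt_0_nat by simp
  show ?case
  proof (cases "X = {}")
    case False
    then obtain v where v: "v \<in> X" by blast
    have iter: "(f ^^ i) w \<in> X" if "w \<in> X" for i w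
      using that psubset.prems(1) by (induction i) auto
    let ?O = "(\<lambda>i. (f ^^ i) v) ` {..<?N}"
    have OX: "?O \<subseteq> X" using iter[OF v] by blast
    have cO: "card ?O = ?N"
      using inj_on_funpow_prime_power[OF p psubset.prems(2)[OF v] psubset.prems(3)[OF v]]
      by (simp add: card_image)
    have inO: "(f ^^ i) v \<in> ?O" for i
    proof -
      have "(f ^^ i) v = (f ^^ (i mod ?N)) v"
        using funpow_mod_eq[OF psubset.prems(2)[OF v]] by simp
      then show ?thesis using N by (metis imageI lessThan_iff mod_less_divisor)
    qed
    have "v \<in> ?O" using inO[of 0] by simp
    then have "X - ?O \<subset> X" using v by blast
    moreover have "f ` (X - ?O) \<subseteq> X - ?O"
    proof clarify
      fix w assume w: "w \<in> X" "w \<notin> ?O"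
      have "f w \<notin> ?O"
      proof
        assume "f w \<in> ?O"
        then obtain i where i: "f w = (f ^^ i) v" by blast
        \<comment> \<open>By periodicity, \<open>?N - 1\<close> more applications of
          \<open>f\<close> lead from \<open>f w\<close> back to \<open>w\<close>, so
          \<open>w\<close> would lie on the cycle of \<open>v\<close>.\<close>
        have "w = (f ^^ (?N - 1)) (f w)"
          using psubset.prems(2)[OF w(1)] N by (metis Suc_diff_1 comp_apply funpow_Suc_right)
        also have "\<dots> = (f ^^ (?N - 1 + i)) v"
          using i by (simp add: funpow_add)
        finally show False using w(2) inO[of "?N - 1 + i"] by simp
      qed
      then show "f w \<in> X - ?O" using w psubset.prems(1) by blast
    qed
    ultimately have "?N dvd card (X - ?O)"
      using psubset.prems by (intro psubset.IH) auto
    moreover have "card X = ?N + card (X - ?O)"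
      using OX cO psubset.hyps card_Diff_subset[of ?O X] card_mono[of X ?O] finite_subset[of ?O X]
      by simp
    ultimately show ?thesis by simp
  qed simp
qed

section \<open>Endomorphisms of \<open>p\<close>-power period on abelian
  \<open>q\<close>-groups\<close>

lemma funpow_hom:
  assumes "f \<in> hom G G"
  shows "f ^^ i \<in> hom G G"
proof (induction i)
  case (Suc i)
  then show ?case using assms Group.hom_compose[of "f ^^ i" G G f G] by (simp add: comp_def)
qed (simp add: hom_def)

lemma (in comm_group) hom_pow_prime_dvd:
  fixes p q :: nat
  assumes pq: "Factorial_Ring.prime p" "Factorial_Ring.prime q" "p \<noteq> q"
    and ord: "order G = q ^ m" and f: "f \<in> hom G G"
    and per: "\<And>x. x \<in> carrier G \<Longrightarrow> (f ^^ (p ^ Suc l)) x = x"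
    and nontriv: "\<exists>x\<in>carrier G. (f ^^ (p ^ l)) x \<noteq> x"
  shows "\<exists>t. 1 \<le> t \<and> t \<le> m \<and> p ^ Suc l dvd q ^ t - 1"
proof -
  define h where "h = f ^^ (p ^ l)"
  \<comment> \<open>In additive notation this is \<open>h - 1\<close>; commutativity makes it a
    homomorphism, so its image is a subgroup.\<close>
  define d where "d = (\<lambda>x. h x \<otimes> inv x)"
  define V where "V = d ` carrier G"
  have fin: "finite (carrier G)"
    using ord pq(2) by (metis order_gt_0_iff_finite prime_gt_0_nat zero_less_power)
  have h: "h \<in> hom G G" unfolding h_def by (rule funpow_hom[OF f])
  interpret F: group_hom G G f
    using f by unfold_locales
  interpret H: group_hom G G h
    using h by unfold_locales
  have d: "d \<in> hom G G"
    by (rule homI) (simp_all add: d_def inv_mult m_ac)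
  have V: "subgroup V G"
    unfolding V_def using d by (intro group_hom.img_is_subgroup) unfold_locales
  then have "V \<subseteq> carrier G" and one: "\<one> \<in> V"
    by (auto simp: subgroup.subset subgroup.one_closed)
  then have finV: "finite V" using fin finite_subset by blast
  obtain t where t: "t \<le> m" "card V = q ^ t"
    using lagrange[OF V] ord pq(2) by (metis divides_primepow_nat dvd_triv_right)
  have "t \<noteq> 0"
  proof
    assume "t = 0"
    then have "V = {\<one>}" using t one by (metis card_1_singletonE power_0 singletonD)
    then have "h x \<otimes> inv x = \<one>" if "x \<in> carrier G" for x
      using that unfolding V_def d_def by blast
    then have "h x = x" if "x \<in> carrier G" for x
      using that inv_equality[of "h x" "inv x"] by simp
    then show False using nontriv unfolding h_def by blast
  qed
  have hp: "(h ^^ p) x = x" if "x \<in> carrier G" for x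
    using per[OF that] unfolding h_def by (simp add: funpow_mult mult.commute)
  \<comment> \<open>If \<open>h\<close> fixes \<open>x\<close>, each application of \<open>h\<close>
    multiplies \<open>y\<close> by another factor \<open>x\<close>. After \<open>p\<close> of them
    \<open>y\<close> returns, so \<open>x [^] p\<close> is trivial, and the order of
    \<open>x\<close> divides both \<open>p\<close> and \<open>q ^ m\<close>.\<close>
  have free: "h x \<noteq> x" if x: "x \<in> V - {\<one>}" for x
  proof
    assume hx: "h x = x"
    obtain y where y: "y \<in> carrier G" "x = h y \<otimes> inv y"
      using x unfolding V_def d_def by blast
    have xc: "x \<in> carrier G" using x \<open>V \<subseteq> carrier G\<close> by blast
    have hy: "h y = y \<otimes> x" using y m_lcomm[of y "h y" "inv y"] by simp
    have hpow: "h (x [^] i) = x [^] i" for i :: nat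
      by (induction i) (use hx xc in auto)
    have "(h ^^ i) y = y \<otimes> x [^] i" for i
    proof (induction i)
      case (Suc i)
      then show ?case
        using y(1) xc hy hpow by (simp add: m_assoc flip: nat_pow_Suc2)
    qed (use y in simp)
    then have "y \<otimes> x [^] p = y" using hp[OF y(1)] by simp
    then have "x [^] p = \<one>" using y(1) xc by simp
    moreover have "x [^] (q ^ m) = \<one>" using pow_order_eq_1[OF xc] ord by simp
    ultimately have "ord x dvd p" "ord x dvd q ^ m"
      using xc by (auto simp: pow_eq_id)
    moreover have "coprime p (q ^ m)"
      using pq by (simp add: primes_coprime)
    ultimately have "ord x = 1" using coprime_common_divisor_nat by blast
    then show False using x xc ord_eq_1 by blast
  qed
  have "f ` (V - {\<one>}) \<subseteq> V - {\<one>}"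
  proof (rule image_subsetI)
    fix x assume "x \<in> V - {\<one>}"
    then have x: "x \<in> V" "x \<noteq> \<one>" by auto
    then obtain y where y: "y \<in> carrier G" "x = d y" unfolding V_def by blast
    \<comment> \<open>As a power of \<open>f\<close>, \<open>h\<close> commutes with
      \<open>f\<close>; hence \<open>f\<close> maps \<open>V\<close> into itself.\<close>
    have "f (h y) = h (f y)"
      by (simp add: h_def funpow_swap1)
    then have "f (d y) = d (f y)"
      using y by (simp add: d_def)
    then have "f x \<in> V" using y by (auto simp: V_def)
    \<comment> \<open>Otherwise all later iterates would be trivial as well, yet the one at
      \<open>p ^ Suc l\<close> is \<open>x\<close>.\<close>
    moreover have "f x \<noteq> \<one>"
    proof
      assume "f x = \<one>"
      moreover obtain N where N: "p ^ Suc l = Suc N"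
        using pq(1) by (metis gr0_conv_Suc prime_gt_0_nat zero_less_power)
      moreover have "(f ^^ N) \<one> = \<one>"
        using hom_one[OF funpow_hom[OF f] is_group is_group] .
      ultimately have "(f ^^ (p ^ Suc l)) x = \<one>"
        by (simp only: funpow_Suc_right comp_apply)
      then show False
        using per[of x] x \<open>V \<subseteq> carrier G\<close> by auto
    qed
    ultimately show "f x \<in> V - {\<one>}" by blast
  qed
  then have "p ^ Suc l dvd card (V - {\<one>})"
  proof (rule prime_power_dvd_card[OF pq(1), rotated])
    show "(f ^^ (p ^ Suc l)) v = v" if "v \<in> V - {\<one>}" for v
      using that \<open>V \<subseteq> carrier G\<close> by (intro per) blast
    show "(f ^^ (p ^ l)) v \<noteq> v" if "v \<in> V - {\<one>}" for v
      using free[OF that] by (simp add: h_def)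
  qed (use finV in simp)
  then show ?thesis
    using t one \<open>t \<noteq> 0\<close> by (intro exI[of _ t]) (simp add: card_Diff_singleton)
qed

section \<open>Elements of prime power order\<close>

lemma (in group) ord_prime_power_iff:
  fixes p :: nat
  assumes "Factorial_Ring.prime p" "a \<in> carrier G"
  shows "(\<exists>i. ord a = p ^ i) \<longleftrightarrow> (\<exists>i::nat. a [^] (p ^ i) = \<one>)"
  using assms by (metis pow_eq_id divides_primepow_nat dvd_refl)

text \<open>For products, \<open>p ^ (i + j)\<close> is a common multiple of both orders, and every
  divisor of it is again a power of \<open>p\<close>.\<close>

lemma (in comm_group) subgroup_prime_power_torsion:
  fixes p :: nat
  assumes "Factorial_Ring.prime p"
  shows "subgroup {a \<in> carrier G. \<exists>i. ord a = p ^ i} G"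
proof (rule subgroupI)
  show "{a \<in> carrier G. \<exists>i. ord a = p ^ i} \<noteq> {}"
    by (auto intro!: exI[of _ \<one>] exI[of _ 0])
next
  fix a b assume a: "a \<in> {a \<in> carrier G. \<exists>i. ord a = p ^ i}"
    and b: "b \<in> {a \<in> carrier G. \<exists>i. ord a = p ^ i}"
  then obtain i j where ij: "ord a = p ^ i" "ord b = p ^ j" by auto
  have "a [^] (p ^ (i + j)) = \<one>" "b [^] (p ^ (i + j)) = \<one>"
    using a b ij by (simp_all add: pow_eq_id power_add)
  then have "(a \<otimes> b) [^] (p ^ (i + j)) = \<one>"
    using a b by (simp add: nat_pow_distrib)
  then show "a \<otimes> b \<in> {a \<in> carrier G. \<exists>i. ord a = p ^ i}"
    using a b assms ord_prime_power_iff by auto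
qed (auto simp: ord_inv)

section \<open>The lambda action of a left brace on its Sylow subgroups\<close>

context left_brace
begin

definition lam :: "'a \<Rightarrow> 'a \<Rightarrow> 'a" where
  "lam a b = a \<otimes> b \<oplus> b"

lemma lam_closed: "a \<in> carrier A \<Longrightarrow> b \<in> carrier A \<Longrightarrow> lam a b \<in> carrier A"
  by (simp add: lam_def m_closed)

lemma lam_add:
  "a \<in> carrier A \<Longrightarrow> b \<in> carrier A \<Longrightarrow> c \<in> carrier A \<Longrightarrow> lam a (b \<oplus> c) = lam a b \<oplus> lam a c"
  by (simp add: lam_def m_closed r_distr a_ac)

lemma lam_hom: "a \<in> carrier A \<Longrightarrow> lam a \<in> hom (add_monoid A) (add_monoid A)"
  by (auto simp: hom_def lam_closed lam_add)

lemma adjoint_mult: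
  "a \<in> carrier A \<Longrightarrow> b \<in> carrier A \<Longrightarrow> a \<otimes>\<^bsub>adjoint_group A\<^esub> b = lam a b \<oplus> a"
  by (simp add: adjoint_group_def lam_def m_closed a_ac)

lemma carrier_adjoint [simp]: "carrier (adjoint_group A) = carrier A"
  and one_adjoint [simp]: "\<one>\<^bsub>adjoint_group A\<^esub> = \<zero>"
  by (simp_all add: adjoint_group_def)

sublocale adj: group "adjoint_group A"
  by (rule group_adjoint_group)

text \<open>Expand both sides of associativity of the circle operation and cancel the common summand
  \<open>lam a b \<oplus> a\<close>.\<close>

lemma lam_adjoint_mult:
  assumes "a \<in> carrier A" "b \<in> carrier A" "c \<in> carrier A"
  shows "lam (a \<otimes>\<^bsub>adjoint_group A\<^esub> b) c = lam a (lam b c)"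
proof -
  have ab: "a \<otimes>\<^bsub>adjoint_group A\<^esub> b \<in> carrier A" and bc: "b \<otimes>\<^bsub>adjoint_group A\<^esub> c \<in> carrier A"
    using adj.m_closed assms by auto
  have "lam (a \<otimes>\<^bsub>adjoint_group A\<^esub> b) c \<oplus> (lam a b \<oplus> a) = lam a (lam b c) \<oplus> (lam a b \<oplus> a)"
    using adj.m_assoc[of a b c] assms ab bc
    by (simp add: adjoint_mult lam_add lam_closed a_assoc)
  then show ?thesis using assms ab by (simp add: lam_closed)
qed

lemma lam_zero: "b \<in> carrier A \<Longrightarrow> lam \<zero> b = b"
  using adj.l_one[of b] by (simp add: adjoint_mult lam_closed)

lemma lam_adjoint_pow:
  assumes "a \<in> carrier A" "b \<in> carrier A"
  shows "lam (a [^]\<^bsub>adjoint_group A\<^esub> (i::nat)) b = (lam a ^^ i) b"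
  using assms(2)
\<comment> \<open>The last circle factor \<open>a\<close> acts first, so the induction hypothesis is
  used at \<open>lam a b\<close>.\<close>
proof (induction i arbitrary: b)
  case (Suc i)
  have "a [^]\<^bsub>adjoint_group A\<^esub> i \<in> carrier A"
    using adj.nat_pow_closed assms(1) by simp
  then show ?case
    using Suc assms(1) by (simp add: lam_adjoint_mult lam_closed funpow_swap1)
qed (simp add: lam_zero)

text \<open>Through this, vanishing products become fixed points of the action, which orbit counting
  can detect.\<close>

lemma mult_eq_zero_iff_lam:
  "a \<in> carrier A \<Longrightarrow> b \<in> carrier A \<Longrightarrow> a \<otimes> b = \<zero> \<longleftrightarrow> lam a b = b"
  by (simp add: lam_def m_closed)

lemma add_sylow_subgroup:
  "Factorial_Ring.prime p \<Longrightarrow> subgroup (add_sylow A p) (add_monoid A)"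
  using comm_group.subgroup_prime_power_torsion[OF a_comm_group]
  by (simp add: add_sylow_def)

text \<open>An additive endomorphism preserves the property of being annihilated by a power of
  \<open>p\<close>.\<close>

lemma lam_add_sylow:
  assumes "Factorial_Ring.prime p" "a \<in> carrier A" "b \<in> add_sylow A p"
  shows "lam a b \<in> add_sylow A p"
proof -
  have b: "b \<in> carrier A" using assms(3) by (simp add: add_sylow_def)
  obtain i :: nat where "b [^]\<^bsub>add_monoid A\<^esub> (p ^ i) = \<one>\<^bsub>add_monoid A\<^esub>"
    using assms(3) group.ord_prime_power_iff[OF a_group assms(1), of b]
    by (auto simp: add_sylow_def)
  then have "lam a b [^]\<^bsub>add_monoid A\<^esub> (p ^ i) = \<one>\<^bsub>add_monoid A\<^esub>"
    using group_hom.hom_nat_pow[of "add_monoid A" "add_monoid A" "lam a" b "p ^ i"]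
      lam_hom[OF assms(2)] b a_group hom_one[OF lam_hom[OF assms(2)] a_group a_group]
    by (simp add: group_hom_def group_hom_axioms_def)
  then show ?thesis
    using group.ord_prime_power_iff[OF a_group assms(1), of "lam a b"] b assms(2)
    by (auto simp: add_sylow_def lam_closed)
qed

text \<open>The circle product of \<open>a\<close> and \<open>b\<close> is
  \<open>lam a b \<oplus> a\<close>, and the circle inverse \<open>?b\<close> of \<open>a\<close>
  equals \<open>\<ominus> lam ?b a\<close>. Closure thus follows from the additive subgroup and its
  invariance under \<open>lam\<close>.\<close>

lemma add_sylow_adjoint_subgroup:
  assumes "Factorial_Ring.prime p"
  shows "subgroup (add_sylow A p) (adjoint_group A)"
proof -
  note S = add_sylow_subgroup[OF assms]
  have sub: "add_sylow A p \<subseteq> carrier A" by (auto simp: add_sylow_def)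
  show ?thesis
  proof (rule adj.subgroupI)
    show "add_sylow A p \<noteq> {}" using subgroup.one_closed[OF S] by auto
  next
    fix a assume a: "a \<in> add_sylow A p"
    then have ac: "a \<in> carrier A" using sub by blast
    let ?b = "inv\<^bsub>adjoint_group A\<^esub> a"
    have b: "?b \<in> carrier A" using adj.inv_closed ac by simp
    have "lam ?b a \<oplus> ?b = \<zero>"
      using adj.l_inv[of a] ac b by (simp add: adjoint_mult)
    then have "?b = \<ominus> lam ?b a"
      using ac b lam_closed by (metis minus_equality a_comm)
    moreover have "\<ominus> lam ?b a \<in> add_sylow A p"
      using subgroup.m_inv_closed[OF S lam_add_sylow[OF assms b a]] by (simp add: a_inv_def)
    ultimately show "?b \<in> add_sylow A p" by simp
  next
    fix a b assume "a \<in> add_sylow A p" "b \<in> add_sylow A p"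
    then show "a \<otimes>\<^bsub>adjoint_group A\<^esub> b \<in> add_sylow A p"
      using subgroup.m_closed[OF S] lam_add_sylow[OF assms] sub
      by (auto simp: adjoint_mult subset_iff)
  qed (use sub in simp)
qed

text \<open>The \<open>p ^ l\<close> constructed here is the order of \<open>lam a\<close>
  restricted to \<open>add_sylow A q\<close>; for \<open>l = 0\<close> the restriction is the
  identity and there is no nontrivial orbit to count.\<close>

lemma lam_prime_power_order:
  assumes pq: "Factorial_Ring.prime p" "Factorial_Ring.prime q" "p \<noteq> q"
    and cp: "card (add_sylow A p) = p ^ n" and cq: "card (add_sylow A q) = q ^ m"
    and a: "a \<in> add_sylow A p"
  obtains l where "\<And>b. b \<in> add_sylow A q \<Longrightarrow> (lam a ^^ (p ^ l)) b = b"
    and "l = 0 \<or> (\<exists>t. 1 \<le> t \<and> t \<le> m \<and> p ^ l dvd q ^ t - 1)"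
proof -
  let ?P = "\<lambda>l. \<forall>b \<in> add_sylow A q. (lam a ^^ (p ^ l)) b = b"
  have ac: "a \<in> carrier A" using a by (simp add: add_sylow_def)
  \<comment> \<open>Lagrange in \<open>add_sylow A p\<close>, taken as a subgroup of the adjoint
    group.\<close>
  have "a [^]\<^bsub>adjoint_group A\<^esub> (p ^ n) = \<zero>"
    using group.pow_order_eq_1[OF subgroup.subgroup_is_group
        [OF add_sylow_adjoint_subgroup[OF pq(1)] group_adjoint_group], of a] a cp
    by (simp add: order_def flip: adj.nat_pow_consistent)
  then have "?P n"
    using lam_adjoint_pow[OF ac, of _ "p ^ n"] by (auto simp: add_sylow_def lam_zero)
  define l where "l = (LEAST l. ?P l)"
  have l: "?P l" unfolding l_def using \<open>?P n\<close> by (rule LeastI)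
  have "\<exists>t. 1 \<le> t \<and> t \<le> m \<and> p ^ l dvd q ^ t - 1" if "l \<noteq> 0"
  proof -
    obtain l' where l': "l = Suc l'" using \<open>l \<noteq> 0\<close> by (cases l) auto
    \<comment> \<open>Minimality of \<open>l\<close> provides the nontrivial power of
      \<open>lam a\<close> that the counting argument starts from.\<close>
    have nP: "\<not> ?P l'" by (rule not_less_Least) (fold l_def, simp add: l')
    let ?G = "(add_monoid A)\<lparr>carrier := add_sylow A q\<rparr>"
    have Qc: "add_sylow A q \<subseteq> carrier A" by (auto simp: add_sylow_def)
    interpret Q: group ?G
      using subgroup.subgroup_is_group[OF add_sylow_subgroup[OF pq(2)] a_group] .
    interpret Q: comm_group ?G
      using Qc by (intro Q.group_comm_groupI) (auto simp: subset_iff intro: a_comm)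
    have "lam a \<in> hom ?G ?G"
      using lam_add_sylow[OF pq(2) ac] lam_add[OF ac] Qc by (intro homI) (simp_all add: subset_iff)
    then show ?thesis
      unfolding l'
    proof (rule Q.hom_pow_prime_dvd[OF pq, rotated])
      show "order ?G = q ^ m" by (simp add: order_def cq)
      show "(lam a ^^ (p ^ Suc l')) b = b" if "b \<in> carrier ?G" for b
        using l that unfolding l' by simp
      show "\<exists>b\<in>carrier ?G. (lam a ^^ (p ^ l')) b \<noteq> b"
        using nP by simp
    qed
  qed
  then have "l = 0 \<or> (\<exists>t. 1 \<le> t \<and> t \<le> m \<and> p ^ l dvd q ^ t - 1)"
    by metis
  with l show thesis by (intro that[of l]) simp_all
qed

end

section \<open>Vanishing of products across the two Sylow subgroups\<close>

theorem theorem5: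
  fixes A :: "('a, 'm) ring_scheme" and p q m n :: nat
  assumes "left_brace A"
    and "Factorial_Ring.prime p" and "Factorial_Ring.prime q" and "p \<noteq> q"
    and "n \<ge> 1" and "m \<ge> 1"
    and "card (add_sylow A p) = p ^ n"
    and "card (add_sylow A q) = q ^ m"
  shows "((\<forall>t. 1 \<le> t \<and> t \<le> m \<longrightarrow> \<not> p dvd q ^ t - 1) \<longrightarrow>
           (\<forall>a \<in> add_sylow A p. \<forall>b \<in> add_sylow A q. a \<otimes>\<^bsub>A\<^esub> b = \<zero>\<^bsub>A\<^esub>))
       \<and> (\<forall>a \<in> add_sylow A p. \<forall>b \<in> add_sylow A q. \<forall>k::nat.
           (\<exists>t. 1 \<le> t \<and> t \<le> m \<and> p ^ k dvd q ^ t - 1) \<and>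
           (\<forall>j. (\<exists>t. 1 \<le> t \<and> t \<le> m \<and> p ^ j dvd q ^ t - 1) \<longrightarrow> j \<le> k) \<longrightarrow>
           (a [^]\<^bsub>adjoint_group A\<^esub> (p ^ k)) \<otimes>\<^bsub>A\<^esub> b = \<zero>\<^bsub>A\<^esub>)"
proof -
  interpret left_brace A by fact
  note order_witness = lam_prime_power_order[OF assms(2-4,7,8)]
  \<comment> \<open>Stated for any bound \<open>k\<close> on the exponents, this serves both claims:
    with the maximal exponent in the second and with \<open>k = 0\<close> in the first. The order
    \<open>p ^ l\<close> of the action divides \<open>p ^ k\<close>.\<close>
  have mult_zero: "(a [^]\<^bsub>adjoint_group A\<^esub> (p ^ k)) \<otimes>\<^bsub>A\<^esub> b = \<zero>\<^bsub>A\<^esub>"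
    if a: "a \<in> add_sylow A p" and b: "b \<in> add_sylow A q"
      and max: "\<And>j. \<exists>t. 1 \<le> t \<and> t \<le> m \<and> p ^ j dvd q ^ t - 1 \<Longrightarrow> j \<le> k" for a b k
  proof -
    obtain l where l: "(lam a ^^ (p ^ l)) b = b"
      and "l = 0 \<or> (\<exists>t. 1 \<le> t \<and> t \<le> m \<and> p ^ l dvd q ^ t - 1)"
      using order_witness[OF a] b by blast
    then have "l \<le> k" using max by blast
    then have "(lam a ^^ (p ^ k)) b = b"
      using funpow_mult_fixed[OF l, of "p ^ (k - l)"] by (simp flip: power_add)
    moreover have ab: "a \<in> carrier A" "b \<in> carrier A" using a b by (auto simp: add_sylow_def)
    moreover have "a [^]\<^bsub>adjoint_group A\<^esub> (p ^ k) \<in> carrier A"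
      using adj.nat_pow_closed ab by simp
    ultimately show ?thesis by (simp add: mult_eq_zero_iff_lam lam_adjoint_pow)
  qed
  have "a \<otimes>\<^bsub>A\<^esub> b = \<zero>\<^bsub>A\<^esub>"
    if nd: "\<forall>t. 1 \<le> t \<and> t \<le> m \<longrightarrow> \<not> p dvd q ^ t - 1"
      and a: "a \<in> add_sylow A p" and b: "b \<in> add_sylow A q" for a b
  proof -
    \<comment> \<open>For \<open>j > 0\<close>, \<open>p\<close> divides \<open>p ^ j\<close> and
      hence \<open>q ^ t - 1\<close>, against \<open>nd\<close>. So \<open>k = 0\<close> is a bound,
      and the power with exponent \<open>p ^ 0\<close> is \<open>a\<close> itself.\<close>
    have "j \<le> 0" if "\<exists>t. 1 \<le> t \<and> t \<le> m \<and> p ^ j dvd q ^ t - 1" for j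
      using that nd by (metis dvd_power dvd_trans le_0_eq neq0_conv)
    then have "(a [^]\<^bsub>adjoint_group A\<^esub> (p ^ 0)) \<otimes>\<^bsub>A\<^esub> b = \<zero>\<^bsub>A\<^esub>"
      by (rule mult_zero[OF a b])
    moreover have "a \<in> carrier A" using a by (simp add: add_sylow_def)
    ultimately show ?thesis using adj.l_one[of a] by (metis adj.nat_pow_eone carrier_adjoint power_0)
  qed
  then show ?thesis using mult_zero by blast
qed

end
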